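(* Identify the letters by ${\tt a}=1$ and ${\tt b}=-1$. The Thue--Morse word ${\tt w}_{\rm TM}$ is the only word ${\tt w}=\ell_0\ell_1\ell_2\cdots\in\mathcal{W}$ starting with ${\tt a}=1$ such that ${\tt w}=r_{\tt w}(1)r_{\tt w}(2)\cdots r_{\tt w}(n)\cdots$, i.e. such that $\ell_{n-1}=r_{\tt w}(n)$ for all $n\geqslant 1$.
   Context: Words are infinite one-sided words ${\tt w}=\ell_0\ell_1\ell_2\cdots$ over $\Sigma=\{{\tt a},{\tt b}\}$, indexed from position $0$. $\mathcal{W}$ is the set of such words in which both ${\tt a}$ and ${\tt b}$ occur infinitely often. For ${\tt w}\in\mathcal{W}$ and $n\geqslant1$, $p_{\tt a}(n)$ (resp. $p_{\tt b}(n)$) is the position of the $n$-th occurrence of ${\tt a}$ (resp. ${\tt b}$) in ${\tt w}$, and the relative position function is $r_{\tt w}(n)=p_{\tt b}(n)-p_{\tt a}(n)$. The Thue--Morse word ${\tt w}_{\rm TM}=\lim_{n\to\infty}\varrho_{\rm TM}^n({\tt a})$ is the fixed point starting with ${\tt a}$ of the substitution $\varrho_{\rm TM}:{\tt a}\mapsto{\tt a}{\tt b},\ {\tt b}\mapsto{\tt b}{\tt a}$. *)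

theory Defs
  imports Complex_Main "HOL-Library.Infinite_Set" "HOL-Library.Sublist"
begin

datatype letter = A | B

type_synonym word = "nat \<Rightarrow> letter"

definition letter_val :: "letter \<Rightarrow> int" where
  "letter_val x = (case x of A \<Rightarrow> 1 | B \<Rightarrow> -1)"

definition words_W :: "word set" where
  "words_W = {w. infinite {i. w i = A} \<and> infinite {i. w i = B}}"

(* Occurrences are counted from 1, whereas enumerate counts from 0;
   the value at n = 0 is meaningless. *)
definition occ_pos :: "word \<Rightarrow> letter \<Rightarrow> nat \<Rightarrow> nat" where
  "occ_pos w x n = enumerate {i. w i = x} (n - 1)"

definition rel_pos :: "word \<Rightarrow> nat \<Rightarrow> int" where
  "rel_pos w n = int (occ_pos w B n) - int (occ_pos w A n)"

fun tm_letter :: "letter \<Rightarrow> letter list" where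
  "tm_letter A = [A, B]"
| "tm_letter B = [B, A]"

definition tm_subst :: "letter list \<Rightarrow> letter list" where
  "tm_subst u = concat (map tm_letter u)"

(* Convergence of finite words to an infinite word: every position is
   eventually defined and eventually carries the letter of the limit. *)
definition word_limit :: "(nat \<Rightarrow> letter list) \<Rightarrow> word \<Rightarrow> bool" where
  "word_limit v w \<longleftrightarrow> (\<forall>i. \<forall>\<^sub>F n in sequentially. i < length (v n) \<and> v n ! i = w i)"

definition tm_word :: word where
  "tm_word = (THE w. word_limit (\<lambda>n. (tm_subst ^^ n) [A]) w)"

lemma word_limit_unique:
  assumes "word_limit v w" "word_limit v w'"
  shows "w = w'"
proof
  fix i
  have "\<forall>\<^sub>F n in sequentially. w i = w' i"
    using assms[unfolded word_limit_def, rule_format, of i]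
    by eventually_elim auto
  then show "w i = w' i" by simp
qed

lemma length_tm_subst: "length (tm_subst u) = 2 * length u"
proof (induction u)
  case (Cons x u)
  then show ?case by (cases x) (auto simp: tm_subst_def)
qed (simp add: tm_subst_def)

lemma length_tm_iter: "length ((tm_subst ^^ n) [A]) = 2 ^ n"
  by (induction n) (auto simp: length_tm_subst)

lemma tm_subst_append: "tm_subst (u @ v) = tm_subst u @ tm_subst v"
  by (simp add: tm_subst_def)

lemma prefix_tm_iter_Suc: "prefix ((tm_subst ^^ n) [A]) ((tm_subst ^^ Suc n) [A])"
proof (induction n)
  case 0
  show ?case by (simp add: tm_subst_def)
next
  case (Suc n)
  then show ?case by (auto simp: prefix_def tm_subst_append)
qed

lemma prefix_tm_iter:
  assumes "m \<le> n"
  shows "prefix ((tm_subst ^^ m) [A]) ((tm_subst ^^ n) [A])"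
  using assms
proof (induction n rule: dec_induct)
  case (step n)
  show ?case
    using step.IH prefix_tm_iter_Suc by (rule prefix_order.trans)
qed simp

lemma word_limit_tm_word: "word_limit (\<lambda>n. (tm_subst ^^ n) [A]) tm_word"
proof -
  let ?v = "\<lambda>n. (tm_subst ^^ n) [A]"
  have "word_limit ?v (\<lambda>i. ?v i ! i)"
    unfolding word_limit_def
  proof
    fix i
    have lt: "i < length (?v i)" by (simp add: length_tm_iter)
    have "i < length (?v n) \<and> ?v n ! i = ?v i ! i" if "n \<ge> i" for n
      using prefix_tm_iter[OF that] lt
      by (auto simp: prefix_def nth_append)
    then show "\<forall>\<^sub>F n in sequentially. i < length (?v n) \<and> ?v n ! i = ?v i ! i"
      unfolding eventually_sequentially by blast
  qed
  then show ?thesis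
    unfolding tm_word_def by (metis theI word_limit_unique)
qed

end

theory Submission
  imports Defs
begin

text \<open>
  If \<open>\<bar>r\<^sub>w(n)\<bar> = 1\<close> for all \<open>n\<close>, then by induction the \<open>n\<close>-th \<open>a\<close> and the \<open>n\<close>-th \<open>b\<close> occupy
  the positions \<open>2n - 2\<close> and \<open>2n - 1\<close>: the earlier pairs fill everything before \<open>2n - 2\<close>, so one
  of the two letters sits at \<open>2n - 2\<close>, and the other one is adjacent to it. The sign of \<open>r\<^sub>w(n)\<close>
  tells which letter comes first, so the equation \<open>\<ell>\<^bsub>n-1\<^esub> = r\<^sub>w(n)\<close> says exactly that the
  block at \<open>2n - 2\<close> is the image of \<open>\<ell>\<^bsub>n-1\<^esub>\<close> under the Thue--Morse substitution.
\<close>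

text \<open>Invariance under the substitution, read off letter by letter so that
  \<open>tm_subst\<close> need not be extended to infinite words. Over two letters the inequality
  pins down the second letter of each block.\<close>

definition tm_fixed :: "word \<Rightarrow> bool" where
  "tm_fixed w \<longleftrightarrow> (\<forall>k. w (2 * k) = w k \<and> w (Suc (2 * k)) \<noteq> w k)"

lemma letter_eq_if_neq:
  fixes x y z :: letter
  assumes "x \<noteq> z" "y \<noteq> z"
  shows "x = y"
  using assms by (cases x; cases y; cases z) auto

lemma tm_subst_nth:
  assumes "i < length u"
  shows "tm_subst u ! (2 * i) = u ! i \<and> tm_subst u ! Suc (2 * i) \<noteq> u ! i"
  using assms
proof (induction u arbitrary: i)
  case (Cons x u)
  then show ?case
    by (cases x; cases i) (auto simp: tm_subst_def)
qed simp

lemma tm_fixed_tm_word: "tm_fixed tm_word"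
  unfolding tm_fixed_def
proof
  fix k
  let ?v = "\<lambda>n. (tm_subst ^^ n) [A]"
  note lim = word_limit_tm_word[unfolded word_limit_def, rule_format]
  \<comment> \<open>Position k is read in the n-th iterate, but 2k and 2k + 1 in the next one, which
    is the image of the n-th; hence the index shift.\<close>
  have "\<forall>\<^sub>F n in sequentially. tm_word (2 * k) = tm_word k \<and> tm_word (Suc (2 * k)) \<noteq> tm_word k"
    using lim[of k] eventually_sequentially_Suc[THEN iffD2, OF lim[of "2 * k"]]
      eventually_sequentially_Suc[THEN iffD2, OF lim[of "Suc (2 * k)"]]
  proof eventually_elim
    case (elim n)
    then show ?case
      using tm_subst_nth[of k "?v n"] by simp
  qed
  then show "tm_word (2 * k) = tm_word k \<and> tm_word (Suc (2 * k)) \<noteq> tm_word k"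
    by simp
qed

lemma tm_word_0: "tm_word 0 = A"
proof -
  have "\<forall>\<^sub>F n in sequentially. tm_word 0 = A"
    using word_limit_tm_word[unfolded word_limit_def, rule_format, of 0]
  proof eventually_elim
    case (elim n)
    then show ?case
      using prefix_tm_iter[of 0 n] by (auto simp: prefix_def)
  qed
  then show ?thesis
    by simp
qed

text \<open>The letter at n is determined by the one at \<open>n div 2\<close>, which is an earlier
  position unless n = 0, so the first letter determines the word.\<close>

lemma tm_fixed_unique:
  assumes "tm_fixed v" "tm_fixed w" "v 0 = w 0"
  shows "v = w"
proof
  fix n
  show "v n = w n"
  proof (induction n rule: less_induct)
    case (less n)
    have eq: "v (n div 2) = w (n div 2)"
      using less[of "n div 2"] assms(3) by (cases "n = 0") auto
    show ?case
    proof (cases "even n")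
      case True
      then show ?thesis
        using assms(1,2)[unfolded tm_fixed_def, rule_format, of "n div 2"] eq by simp
    next
      case False
      then have "Suc (2 * (n div 2)) = n"
        by simp
      then show ?thesis
        using assms(1,2)[unfolded tm_fixed_def, rule_format, of "n div 2"] eq
          letter_eq_if_neq[of "v n" "w (n div 2)" "w n"]
        by simp
    qed
  qed
qed

lemma enumerate_range_strict_mono:
  fixes f :: "nat \<Rightarrow> nat"
  assumes "strict_mono f"
  shows "enumerate (range f) = f"
proof
  fix n
  have inf: "infinite (range f)"
    using assms by (simp add: finite_image_iff strict_mono_imp_inj_on)
  show "enumerate (range f) n = f n"
  proof (induction n rule: less_induct)
    case (less n)
    \<comment> \<open>Each sequence hits the n-th value of the other. An index below n would, by
      induction, repeat a value of a strictly increasing sequence, so both indices are at least n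
      and each value bounds the other.\<close>
    obtain m where m: "enumerate (range f) n = f m"
      using enumerate_in_set[OF inf, of n] by auto
    obtain k where k: "f n = enumerate (range f) k"
      using enumerate_Ex[OF inf, of "f n"] by (metis rangeI)
    have "k \<ge> n"
      using less k assms by (metis linorder_not_le strict_mono_less less_irrefl)
    then have "enumerate (range f) n \<le> f n"
      using k inf by simp
    moreover have "m \<ge> n"
      using less m inf by (metis enumerate_mono linorder_not_le less_irrefl)
    ultimately show ?case
      using m assms by (metis antisym strict_mono_less_eq)
  qed
qed

text \<open>Every block {2k, 2k + 1} contains each letter exactly once, so occurrence k of
  \<open>x\<close>, counted from 0, lies in block k, in front precisely when
  \<open>w k = x\<close>.\<close>

lemma tm_fixed_occurrences:
  assumes "tm_fixed w"
  shows "infinite {i. w i = x}"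
    and "enumerate {i. w i = x} k = 2 * k + (if w k = x then 0 else 1)"
proof -
  define f where "f = (\<lambda>k. 2 * k + (if w k = x then 0 else 1 :: nat))"
  have mono: "strict_mono f"
    unfolding strict_mono_Suc_iff f_def by simp
  have fixed: "w (2 * k) = w k" "w (Suc (2 * k)) \<noteq> w k" for k
    using assms by (auto simp: tm_fixed_def)
  have "{i. w i = x} = range f"
  proof (intro equalityI subsetI)
    fix i
    assume "i \<in> {i. w i = x}"
    then have "w i = x"
      by simp
    moreover have "i = 2 * (i div 2) \<or> i = Suc (2 * (i div 2))"
      by presburger
    ultimately have "i = f (i div 2)"
      using fixed[of "i div 2"] unfolding f_def
      by (auto split: if_splits)
    then show "i \<in> range f"
      by blast
  next
    fix i
    assume "i \<in> range f"
    then obtain k where "i = f k"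
      by blast
    then have "w i = x"
      using fixed[of k] letter_eq_if_neq[of "w i" "w k" x]
      by (auto simp: f_def split: if_splits)
    then show "i \<in> {i. w i = x}"
      by simp
  qed
  then show "infinite {i. w i = x}"
    and "enumerate {i. w i = x} k = 2 * k + (if w k = x then 0 else 1)"
    using mono enumerate_range_strict_mono[OF mono]
    by (auto simp: finite_image_iff strict_mono_imp_inj_on f_def)
qed

lemma enumerate_complement_pairs:
  fixes S :: "nat set"
  assumes "infinite S" "infinite (- S)"
    and adj: "\<And>k. \<bar>int (enumerate (- S) k) - int (enumerate S k)\<bar> = 1"
  shows "{enumerate S k, enumerate (- S) k} = {2 * k, Suc (2 * k)}"
proof (induction k rule: less_induct)
  case (less k)
  have in_S: "enumerate S j \<in> S" and notin_S: "enumerate (- S) j \<notin> S" for j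
    using enumerate_in_set[OF assms(1)] enumerate_in_set[OF assms(2)] by auto
  have filled: "\<exists>j<k. i = enumerate S j \<or> i = enumerate (- S) j" if "i < 2 * k" for i
  proof -
    have "i div 2 < k" "i \<in> {2 * (i div 2), Suc (2 * (i div 2))}"
      using that by auto
    then show ?thesis
      using less by blast
  qed
  \<comment> \<open>A value below 2k would already be enumerated at some j < k, against strict
    monotonicity or disjointness of \<open>S\<close> and \<open>- S\<close>.\<close>
  have S_ge: "enumerate S k \<ge> 2 * k"
    using filled[of "enumerate S k"] in_S notin_S enumerate_mono[OF _ assms(1)]
    by (metis linorder_not_le less_irrefl)
  have T_ge: "enumerate (- S) k \<ge> 2 * k"
    using filled[of "enumerate (- S) k"] in_S notin_S enumerate_mono[OF _ assms(2)]
    by (metis linorder_not_le less_irrefl)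
  \<comment> \<open>The number 2k is itself enumerated on one side. Its index m is not below k,
    since pair m ends at 2m + 1 < 2k, so entry k on that side is at most 2k.\<close>
  obtain m where m: "enumerate S m = 2 * k \<or> enumerate (- S) m = 2 * k"
    using enumerate_Ex[of S] enumerate_Ex[of "- S"] assms(1,2)
    by (metis ComplI)
  have "\<not> m < k"
  proof
    assume "m < k"
    then have "enumerate S m \<le> Suc (2 * m)" "enumerate (- S) m \<le> Suc (2 * m)"
      using less[of m] by (auto simp: doubleton_eq_iff)
    with m \<open>m < k\<close> show False
      by auto
  qed
  then have "enumerate S k \<le> 2 * k \<or> enumerate (- S) k \<le> 2 * k"
    using m assms(1,2) by (metis enumerate_mono_le_iff linorder_not_le)
  then show ?case
    using S_ge T_ge adj[of k] by (auto simp: doubleton_eq_iff)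
qed

lemma Collect_B_eq: "{i. w i = B} = - {i. w i = A}"
proof -
  have "x = B \<longleftrightarrow> x \<noteq> A" for x
    by (cases x) auto
  then show ?thesis
    by auto
qed

lemma rel_pos_Suc:
  "rel_pos w (Suc k) = int (enumerate {i. w i = B} k) - int (enumerate {i. w i = A} k)"
  by (simp add: rel_pos_def occ_pos_def)

lemma tm_fixed_iff_rel_pos:
  "tm_fixed w \<longleftrightarrow> w \<in> words_W \<and> (\<forall>k. letter_val (w k) = rel_pos w (Suc k))"
proof (intro iffI conjI allI)
  assume fixed: "tm_fixed w"
  show "w \<in> words_W"
    using tm_fixed_occurrences(1)[OF fixed] by (simp add: words_W_def)
  show "letter_val (w k) = rel_pos w (Suc k)" for k
    by (cases "w k") (simp_all add: rel_pos_Suc tm_fixed_occurrences(2)[OF fixed] letter_val_def)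
next
  assume *: "w \<in> words_W \<and> (\<forall>k. letter_val (w k) = rel_pos w (Suc k))"
  define S where "S = {i. w i = A}"
  have inf: "infinite S" "infinite (- S)"
    using * by (auto simp: words_W_def Collect_B_eq S_def)
  have val: "int (enumerate (- S) k) - int (enumerate S k) = letter_val (w k)" for k
    using * by (simp add: rel_pos_Suc Collect_B_eq S_def)
  have "\<bar>letter_val x\<bar> = 1" for x
    by (cases x) (auto simp: letter_val_def)
  then have pairs: "{enumerate S k, enumerate (- S) k} = {2 * k, Suc (2 * k)}" for k
    using enumerate_complement_pairs[OF inf] val by simp
  have mem: "w (enumerate S k) = A" "w (enumerate (- S) k) = B" for k
    using enumerate_in_set[OF inf(1), of k] enumerate_in_set[OF inf(2), of k]
    by (auto simp: S_def Collect_B_eq[symmetric])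
  show "tm_fixed w"
    unfolding tm_fixed_def
  proof
    fix k
    show "w (2 * k) = w k \<and> w (Suc (2 * k)) \<noteq> w k"
      \<comment> \<open>Value 1 puts the \<open>A\<close> of pair k at 2k, and value -1 puts the
        \<open>B\<close> there: in both cases the block opens with \<open>w k\<close>.\<close>
      using pairs[of k] val[of k] mem[of k]
      by (cases "w k") (auto simp: doubleton_eq_iff letter_val_def)
  qed
qed

theorem theorem6p3:
  fixes w :: word
  shows "(w \<in> words_W \<and> w 0 = A \<and> (\<forall>n\<ge>1. letter_val (w (n - 1)) = rel_pos w n))
         \<longleftrightarrow> w = tm_word"
proof -
  \<comment> \<open>Substituting n = \<open>Suc k\<close> passes from counting at 1 to counting at
    0.\<close>
  have "(\<forall>n\<ge>1. letter_val (w (n - 1)) = rel_pos w n)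
      \<longleftrightarrow> (\<forall>k. letter_val (w k) = rel_pos w (Suc k))"
    by (metis One_nat_def Suc_le_D diff_Suc_1 le_add1 plus_1_eq_Suc)
  then show ?thesis
    using tm_fixed_iff_rel_pos[of w] tm_fixed_unique[of w tm_word] tm_fixed_tm_word tm_word_0
    by auto
qed

end
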